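(* Let $\ell$ be an arbitrary admissible transversal of a triangle $ABC$, meeting the sidelines $BC$, $CA$, $AB$ at $D$, $E$, $F$ respectively. Let $G$, $H$, $I$ be the $X_n$-points of the corner triangles $AEF$, $BFD$, $CDE$ respectively. If $$n\in\{3, 4, 19, 24, 25, 48, 49, 63, 68, 69, 92, 93, 184, 186, 264, 265, 304, 305, 317, 328, 340, 378, 563, 847\},$$ then triangles $ABC$ and $GHI$ are perspective, i.e. the lines $AG$, $BH$, $CI$ are concurrent.
   Context: An admissible transversal of $\triangle ABC$ is a line that passes through no vertex of the triangle and is parallel to no side. $X_n$ denotes the $n$-th triangle center in Kimberling's Encyclopedia of Triangle Centers (ETC). For the centers occurring here, the $X_n$-point of a triangle $P_1P_2P_3$ with angles $A_1,A_2,A_3$ is the point with homogeneous barycentric coordinates $(g_n(A_1):g_n(A_2):g_n(A_3))$ relative to $P_1P_2P_3$, where $g_n(A)$ is: $g_{3}=\sin 2A$; $g_{4}=\tan A$; $g_{19}=\sin A\tan A$; $g_{24}=\tan A\cos 2A$; $g_{25}=\sin^2A\tan A$; $g_{48}=\sin A\sin 2A$; $g_{49}=\sin A\cos 3A$; $g_{63}=\cos A$; $g_{68}=\tan 2A$; $g_{69}=\cot A$; $g_{92}=\sec A$; $g_{93}=\sin A\sec 3A$; $g_{184}=\sin^3A\cos A$; $g_{186}=\sin A\sin 3A\csc 2A$; $g_{264}=\csc 2A$; $g_{265}=\sin A\sin 2A\csc 3A$; $g_{304}=\cos A\csc^2A$; $g_{305}=\csc^3A\cos A$; $g_{317}=\cot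 2A$; $g_{328}=\cos A\csc 3A$; $g_{340}=\sec A\sin 3A\csc^2A$; $g_{378}=\tan A+\sin 2A$; $g_{563}=\sin A\sin 4A$; $g_{847}=\tan A\sec 2A$. Points at infinity are allowed: three mutually parallel lines count as concurrent. It is tacitly understood that the $X_n$-points of the three corner triangles are defined and that $G\ne A$, $H\ne B$, $I\ne C$, so that the lines $AG,BH,CI$ make sense. *)

theory Defs
  imports "HOL-Analysis.Analysis"
begin

definition is_line :: "(real^2) set \<Rightarrow> bool" where
  "is_line L \<longleftrightarrow> affine L \<and> aff_dim L = 1"

definition sideline :: "real^2 \<Rightarrow> real^2 \<Rightarrow> (real^2) set" where
  "sideline P Q = affine hull {P, Q}"

definition admissible_transversal ::
    "(real^2) set \<Rightarrow> real^2 \<Rightarrow> real^2 \<Rightarrow> real^2 \<Rightarrow> bool" where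
  "admissible_transversal L A B C \<longleftrightarrow>
     is_line L \<and> A \<notin> L \<and> B \<notin> L \<and> C \<notin> L \<and>
     \<not> affine_parallel L (sideline B C) \<and>
     \<not> affine_parallel L (sideline C A) \<and>
     \<not> affine_parallel L (sideline A B)"

text \<open>The unoriented angle at the vertex \<open>Q\<close>.\<close>

definition angle_at :: "real^2 \<Rightarrow> real^2 \<Rightarrow> real^2 \<Rightarrow> real" where
  "angle_at P Q R = arccos (((P - Q) \<bullet> (R - Q)) / (norm (P - Q) * norm (R - Q)))"

text \<open>
  The extended (projective) plane in homogeneous coordinates: a point is a nonzero vector
  of \<open>real^3\<close>, determined up to a nonzero factor; the points at infinity are those with third
  coordinate zero. A line is a two-dimensional subspace.
\<close>

definition homog :: "real^2 \<Rightarrow> real^3" where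
  "homog P = vector [P $ 1, P $ 2, 1]"

definition same_point :: "real^3 \<Rightarrow> real^3 \<Rightarrow> bool" where
  "same_point X Y \<longleftrightarrow> (\<exists>k. k \<noteq> 0 \<and> Y = k *\<^sub>R X)"

text \<open>This is a line only if \<open>X\<close> and \<open>Y\<close> represent different points.\<close>

definition proj_line :: "real^3 \<Rightarrow> real^3 \<Rightarrow> (real^3) set" where
  "proj_line X Y = span {X, Y}"

text \<open>
  The common point may lie at infinity, so three mutually parallel lines are concurrent.
\<close>

definition concurrent :: "(real^3) set \<Rightarrow> (real^3) set \<Rightarrow> (real^3) set \<Rightarrow> bool" where
  "concurrent l m n \<longleftrightarrow> (\<exists>Z. Z \<noteq> 0 \<and> Z \<in> l \<and> Z \<in> m \<and> Z \<in> n)"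

definition perspective ::
    "real^3 \<Rightarrow> real^3 \<Rightarrow> real^3 \<Rightarrow> real^3 \<Rightarrow> real^3 \<Rightarrow> real^3 \<Rightarrow> bool" where
  "perspective A B C G H I \<longleftrightarrow>
     concurrent (proj_line A G) (proj_line B H) (proj_line C I)"

definition sec :: "real \<Rightarrow> real" where "sec x = 1 / cos x"
definition csc :: "real \<Rightarrow> real" where "csc x = 1 / sin x"

text \<open>
  Each entry is \<open>(n, g, d)\<close>, where \<open>g\<close> is the value of \<open>g\<^sub>n\<close> at \<open>x\<close> and \<open>d\<close> is the product of
  the denominators hidden in the tangents, cotangents, secants and cosecants of that formula.
  Since division by zero yields zero in HOL, \<open>d \<noteq> 0\<close> is what expresses that \<open>g\<^sub>n\<close> is
  defined at \<open>x\<close>.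
\<close>

definition center_table :: "real \<Rightarrow> (nat \<times> real \<times> real) list" where
  "center_table x =
    [(3,   sin (2*x),                          1),
     (4,   tan x,                              cos x),
     (19,  sin x * tan x,                      cos x),
     (24,  tan x * cos (2*x),                  cos x),
     (25,  (sin x)^2 * tan x,                  cos x),
     (48,  sin x * sin (2*x),                  1),
     (49,  sin x * cos (3*x),                  1),
     (63,  cos x,                              1),
     (68,  tan (2*x),                          cos (2*x)),
     (69,  cot x,                              sin x),
     (92,  sec x,                              cos x),
     (93,  sin x * sec (3*x),                  cos (3*x)),
     (184, (sin x)^3 * cos x,                  1),
     (186, sin x * sin (3*x) * csc (2*x),      sin (2*x)),
     (264, csc (2*x),                          sin (2*x)),
     (265, sin x * sin (2*x) * csc (3*x),      sin (3*x)),
     (304, cos x * (csc x)^2,                  sin x),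
     (305, (csc x)^3 * cos x,                  sin x),
     (317, cot (2*x),                          sin (2*x)),
     (328, cos x * csc (3*x),                  sin (3*x)),
     (340, sec x * sin (3*x) * (csc x)^2,      cos x * sin x),
     (378, tan x + sin (2*x),                  cos x),
     (563, sin x * sin (4*x),                  1),
     (847, tan x * sec (2*x),                  cos x * cos (2*x))]"

definition center_fun :: "nat \<Rightarrow> real \<Rightarrow> real" where
  "center_fun n x = fst (the (map_of (center_table x) n))"

definition center_fun_defined :: "nat \<Rightarrow> real \<Rightarrow> bool" where
  "center_fun_defined n x \<longleftrightarrow> 
     n \<in> fst ` set (center_table x) \<and> snd (the (map_of (center_table x) n)) \<noteq> 0"

text \<open>
  \<open>X\<close> represents the point with homogeneous barycentric coordinates \<open>(u : v : w)\<close> relative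
  to the triangle \<open>PQR\<close>; it lies at infinity iff \<open>u + v + w = 0\<close>.
\<close>

definition has_barycentrics ::
    "real^3 \<Rightarrow> real^2 \<Rightarrow> real^2 \<Rightarrow> real^2 \<Rightarrow> real \<Rightarrow> real \<Rightarrow> real \<Rightarrow> bool" where
  "has_barycentrics X P Q R u v w \<longleftrightarrow>
     (u, v, w) \<noteq> (0, 0, 0) \<and>
     same_point (u *\<^sub>R homog P + v *\<^sub>R homog Q + w *\<^sub>R homog R) X"

definition is_center :: "nat \<Rightarrow> real^2 \<Rightarrow> real^2 \<Rightarrow> real^2 \<Rightarrow> real^3 \<Rightarrow> bool" where
  "is_center n P Q R X \<longleftrightarrow>
     (let a = angle_at R P Q; b = angle_at P Q R; c = angle_at Q R P in
        center_fun_defined n a \<and> center_fun_defined n b \<and> center_fun_defined n c \<and>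
        has_barycentrics X P Q R (center_fun n a) (center_fun n b) (center_fun n c))"

end

theory Submission
  imports Defs
begin

text \<open>
  All the functions \<open>g\<^sub>n\<close> satisfy \<open>g (\<pi> - x) = - g x\<close>, and nothing else about them matters.
  Let \<open>D = d\<^sub>B B + d\<^sub>C C\<close>, \<open>E = e\<^sub>A A + e\<^sub>C C\<close>, \<open>F = f\<^sub>A A + f\<^sub>B B\<close> be the affine coordinates
  of the three intersection points. Modulo multiples of \<open>A\<close> and nonzero factors, the point \<open>G\<close> is
  \<open>g (\<angle>AEF) e\<^sub>C C + g (\<angle>EFA) f\<^sub>B B\<close>, and similarly for \<open>H\<close> and \<open>I\<close>, so by Ceva's
  theorem (lemma \<open>ceva_concurrent\<close>) the lines \<open>AG\<close>, \<open>BH\<close>, \<open>CI\<close> concur once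
  \<open>g (\<angle>AEF) e\<^sub>C g (\<angle>BFD) f\<^sub>A g (\<angle>CDE) d\<^sub>B = g (\<angle>EFA) f\<^sub>B g (\<angle>FDB) d\<^sub>C g (\<angle>DEC) e\<^sub>A\<close>.
  Now the two corner triangles that meet at \<open>E\<close> have equal or supplementary angles there, so
  that \<open>g (\<angle>AEF) = \<plusminus> g (\<angle>DEC)\<close>, and the same holds at \<open>D\<close> and \<open>F\<close>. Up to sign the
  identity is therefore the theorem of Menelaus,
  \<open>e\<^sub>C f\<^sub>A d\<^sub>B = - e\<^sub>A f\<^sub>B d\<^sub>C\<close>. Lemma \<open>odd_fun_angle_at\<close> accounts for the signs: replacing a
  side of an angle by a nonzero multiple of it multiplies \<open>g\<close> of the angle by the sign of the factor.
  These signs turn the affine coordinates in the identity into their absolute values, and the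
  position of \<open>F\<close> on the line \<open>DE\<close> contributes the same sign to both sides.
\<close>

section \<open>Center functions at supplementary angles\<close>

lemma center_fun_pi_minus:
  assumes "n \<in> {3, 4, 19, 24, 25, 48, 49, 63, 68, 69, 92, 93, 184, 186, 264, 265,
                304, 305, 317, 328, 340, 378, 563, 847}"
  shows "center_fun n (pi - x) = - center_fun n x"
proof -
  have 2: "sin (2 * (pi - x)) = - sin (2 * x)" "cos (2 * (pi - x)) = cos (2 * x)"
    by (simp_all add: sin_diff cos_diff right_diff_distrib)
  have "3 * (pi - x) = (pi - 3 * x) + 2 * pi"
    by simp
  then have 3: "sin (3 * (pi - x)) = sin (3 * x)" "cos (3 * (pi - x)) = - cos (3 * x)"
    by (simp_all only: sin_periodic cos_periodic sin_pi_minus cos_pi_minus)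
  have "4 * (pi - x) = ((- (4 * x)) + 2 * pi) + 2 * pi"
    by simp
  then have 4: "sin (4 * (pi - x)) = - sin (4 * x)"
    by (simp only: sin_periodic sin_minus)
  show ?thesis
    using assms
    by (elim insertE emptyE)
       (simp_all add: center_fun_def center_table_def sec_def csc_def tan_def cot_def 2 3 4
         del: right_diff_distrib_numeral)
qed

text \<open>
  Here \<open>u\<close> and \<open>v\<close> are direction vectors of the two sides of the angle, of either orientation.
\<close>

lemma odd_fun_angle_at:
  fixes g :: "real \<Rightarrow> real"
  assumes g: "\<And>x. g (pi - x) = - g x"
    and "s \<noteq> 0" "t \<noteq> 0"
    and P: "P - Q = s *\<^sub>R u" and R: "R - Q = t *\<^sub>R v"
  shows "g (angle_at P Q R) = sgn s * sgn t * g (arccos ((u \<bullet> v) / (norm u * norm v)))"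
proof -
  define k where "k = (u \<bullet> v) / (norm u * norm v)"
  have "\<bar>k\<bar> \<le> 1"
    using Cauchy_Schwarz_ineq2[of u v] by (auto simp: k_def abs_mult divide_le_eq_1 zero_less_mult_iff)
  moreover have "angle_at P Q R = arccos (sgn s * sgn t * k)"
    unfolding angle_at_def P R k_def
    using assms(2,3) by (simp add: sgn_if mult.assoc)
  ultimately show ?thesis
    unfolding k_def[symmetric] using assms(2,3)
    by (auto simp: sgn_if arccos_minus abs_le_iff g)
qed

section \<open>Affine and homogeneous coordinates\<close>

lemma collinear_affine_dependence:
  fixes A B C :: "'a::euclidean_space"
  assumes "x *\<^sub>R A + y *\<^sub>R B + z *\<^sub>R C = 0" "x + y + z = 0" "x \<noteq> 0"
  shows "collinear {A, B, C}"
proof (cases "B = C")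
  case True
  then show ?thesis by simp
next
  case False
  have "x *\<^sub>R A = (- y) *\<^sub>R B + (- z) *\<^sub>R C"
    using assms(1) by (simp add: eq_neg_iff_add_eq_0 add_ac eq_diff_eq)
  then have "(1 / x) *\<^sub>R x *\<^sub>R A = (1 / x) *\<^sub>R ((- y) *\<^sub>R B + (- z) *\<^sub>R C)"
    by simp
  then have "A = (- y / x) *\<^sub>R B + (- z / x) *\<^sub>R C"
    using \<open>x \<noteq> 0\<close> by (simp add: scaleR_add_right scaleR_diff_right)
  moreover have "- y / x + - z / x = 1"
    using assms(2,3) by (simp add: field_simps)
  ultimately have "A \<in> affine hull {B, C}"
    unfolding affine_hull_2 by blast
  then have "collinear {B, C, A}"
    using False by (simp add: collinear_3_affine_hull)
  then show ?thesis
    by (simp add: insert_commute)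
qed

lemma noncollinear_coeffs_zero:
  fixes A B C :: "'a::euclidean_space"
  assumes nc: "\<not> collinear {A, B, C}"
    and "x *\<^sub>R A + y *\<^sub>R B + z *\<^sub>R C = 0" "x + y + z = 0"
  shows "x = 0 \<and> y = 0 \<and> z = 0"
proof -
  have "x = 0"
    using assms collinear_affine_dependence by blast
  moreover have "y = 0"
    using assms collinear_affine_dependence[of y B x A z C]
    by (metis add.commute insert_commute)
  ultimately show ?thesis
    using assms(3) by simp
qed

lemma homog_affine: "s + t = 1 \<Longrightarrow> homog (s *\<^sub>R P + t *\<^sub>R Q) = s *\<^sub>R homog P + t *\<^sub>R homog Q"
  by (simp add: homog_def vec_eq_iff forall_3)

lemma homog_independent:
  assumes "\<not> collinear {A, B, C}"
    and 0: "x *\<^sub>R homog A + y *\<^sub>R homog B + z *\<^sub>R homog C = 0"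
  shows "x = 0 \<and> y = 0 \<and> z = 0"
proof (rule noncollinear_coeffs_zero[OF assms(1)])
  show "x *\<^sub>R A + y *\<^sub>R B + z *\<^sub>R C = 0" "x + y + z = 0"
    using 0 by (simp_all add: homog_def vec_eq_iff forall_3 forall_2)
qed

lemma affine_hull_2_obtain:
  fixes P Q :: "'a::real_vector"
  assumes "X \<in> affine hull {P, Q}" "X \<noteq> P" "X \<noteq> Q"
  obtains s t where "X = s *\<^sub>R P + t *\<^sub>R Q" "s + t = 1" "s \<noteq> 0" "t \<noteq> 0"
proof -
  obtain s t where st: "X = s *\<^sub>R P + t *\<^sub>R Q" "s + t = 1"
    using assms(1) unfolding affine_hull_2 by blast
  moreover have "s \<noteq> 0" "t \<noteq> 0"
    using st assms(2,3) by auto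
  ultimately show thesis
    using that by blast
qed

section \<open>Cevians and Ceva's theorem\<close>

text \<open>
  The first vertex and the point \<open>G\<close> span the same line as that vertex and a point of the
  opposite sideline, possibly at infinity; the coordinates of the latter do not both vanish because \<open>G\<close> is not the vertex.
\<close>

lemma corner_cevian:
  assumes X: "has_barycentrics G A E F u v w"
    and ne: "\<not> same_point (homog A) G"
    and E: "E = e' *\<^sub>R A + e *\<^sub>R C" "e' + e = 1" "e \<noteq> 0"
    and F: "F = f' *\<^sub>R A + f *\<^sub>R B" "f' + f = 1" "f \<noteq> 0"
  shows "(v * e \<noteq> 0 \<or> w * f \<noteq> 0) \<and>
    (\<forall>x y. x *\<^sub>R homog A + y *\<^sub>R ((w * f) *\<^sub>R homog B + (v * e) *\<^sub>R homog C)
      \<in> proj_line (homog A) G)"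
proof -
  obtain k where k: "k \<noteq> 0"
    and G: "G = k *\<^sub>R (u *\<^sub>R homog A + v *\<^sub>R homog E + w *\<^sub>R homog F)"
    and uvw: "(u, v, w) \<noteq> (0, 0, 0)"
    using X by (auto simp: has_barycentrics_def same_point_def)
  let ?V = "(w * f) *\<^sub>R homog B + (v * e) *\<^sub>R homog C"
  let ?c = "u + v * e' + w * f'"
  have G': "G = k *\<^sub>R (?c *\<^sub>R homog A + ?V)"
    unfolding G E(1) F(1) homog_affine[OF E(2)] homog_affine[OF F(2)]
    by (simp add: algebra_simps)
  have "v * e \<noteq> 0 \<or> w * f \<noteq> 0"
  proof (rule ccontr)
    assume "\<not> ?thesis"
    then have vw: "v = 0" "w = 0"
      using E(3) F(3) by auto
    then have "G = (k * u) *\<^sub>R homog A" "k * u \<noteq> 0"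
      using G k uvw by simp_all
    then show False
      using ne unfolding same_point_def by blast
  qed
  moreover have "x *\<^sub>R homog A + y *\<^sub>R ?V \<in> proj_line (homog A) G" for x y
  proof -
    have "x *\<^sub>R homog A + y *\<^sub>R ?V = (x - y * ?c) *\<^sub>R homog A + (y / k) *\<^sub>R G"
      unfolding G' using k by (simp add: algebra_simps)
    then show ?thesis
      unfolding proj_line_def
      by (simp only:) (intro span_add span_scale span_base; simp)
  qed
  ultimately show ?thesis
    by blast
qed

text \<open>
  Ceva's theorem in homogeneous coordinates with respect to a basis \<open>a, b, c\<close>: the lines join
  the basis points to \<open>(0 : p : q)\<close>, \<open>(r : 0 : s)\<close> and \<open>(t : z : 0)\<close>, which may themselves
  be basis points.
\<close>

lemma ceva_concurrent:
  fixes a b c :: "real^3"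
  assumes indep: "\<And>x y z. x *\<^sub>R a + y *\<^sub>R b + z *\<^sub>R c = 0 \<Longrightarrow> x = 0 \<and> y = 0 \<and> z = 0"
    and l: "q \<noteq> 0 \<or> p \<noteq> 0" "\<And>x y. x *\<^sub>R a + y *\<^sub>R (p *\<^sub>R b + q *\<^sub>R c) \<in> l"
    and m: "r \<noteq> 0 \<or> s \<noteq> 0" "\<And>x y. x *\<^sub>R b + y *\<^sub>R (s *\<^sub>R c + r *\<^sub>R a) \<in> m"
    and n: "z \<noteq> 0 \<or> t \<noteq> 0" "\<And>x y. x *\<^sub>R c + y *\<^sub>R (t *\<^sub>R a + z *\<^sub>R b) \<in> n"
    and ceva: "q * r * z = p * s * t"
  shows "concurrent l m n"
proof -
  consider "q = 0" "s = 0" | "q \<noteq> 0" "s \<noteq> 0" | "q = 0" "s \<noteq> 0" | "q \<noteq> 0" "s = 0"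
    by blast
  then show ?thesis
  proof cases
    \<comment> \<open>The first two lines coincide with \<open>ab\<close>; the third line meets it in \<open>(t : z : 0)\<close>.\<close>
    case 1
    then have pr: "p \<noteq> 0" "r \<noteq> 0"
      using l m by auto
    let ?Z = "t *\<^sub>R a + z *\<^sub>R b"
    have "?Z \<noteq> 0"
      using indep[of t z 0] n(1) by auto
    moreover have "?Z \<in> l" "?Z \<in> m" "?Z \<in> n"
      using l(2)[of t "z / p"] m(2)[of z "t / r"] n(2)[of 0 1] 1 pr by (simp_all add: add_ac)
    ultimately show ?thesis
      unfolding concurrent_def by blast
  next
    \<comment> \<open>The first two lines meet in \<open>(q r : p s : q s)\<close>, and this point is off the line \<open>ab\<close>.\<close>
    case 2
    let ?Z = "(q * r) *\<^sub>R a + (p * s) *\<^sub>R b + (q * s) *\<^sub>R c"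
    have "?Z \<noteq> 0"
      using indep[of "q * r" "p * s" "q * s"] 2 by auto
    moreover have "?Z \<in> l" "?Z \<in> m"
      using l(2)[of "q * r" s] m(2)[of "p * s" q] by (simp_all add: algebra_simps)
    moreover have "?Z \<in> n"
    proof (cases "t = 0")
      case True
      then have "z \<noteq> 0" "r = 0"
        using n(1) ceva 2 by auto
      then show ?thesis
        using n(2)[of "q * s" "p * s / z"] True by (simp add: algebra_simps)
    next
      case False
      then have "p * s = q * r * z / t"
        using ceva by (simp add: field_simps)
      then show ?thesis
        using n(2)[of "q * s" "q * r / t"] False by (simp add: algebra_simps)
    qed
    ultimately show ?thesis
      unfolding concurrent_def by blast
  next
    \<comment> \<open>The first line is \<open>ab\<close>, so the three lines pass through \<open>b\<close>.\<close>
    case 3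
    then have p: "p \<noteq> 0" "t = 0" "z \<noteq> 0"
      using l(1) n(1) ceva by auto
    have "b \<noteq> 0"
      using indep[of 0 1 0] by auto
    moreover have "b \<in> l" "b \<in> m" "b \<in> n"
      using l(2)[of 0 "1 / p"] m(2)[of 1 0] n(2)[of 0 "1 / z"] 3 p by simp_all
    ultimately show ?thesis
      unfolding concurrent_def by blast
  next
    \<comment> \<open>The second line is \<open>ab\<close>, so the three lines pass through \<open>a\<close>.\<close>
    case 4
    then have r: "r \<noteq> 0" "z = 0" "t \<noteq> 0"
      using m(1) n(1) ceva by auto
    have "a \<noteq> 0"
      using indep[of 1 0 0] by auto
    moreover have "a \<in> l" "a \<in> m" "a \<in> n"
      using l(2)[of 1 0] m(2)[of 0 "1 / r"] n(2)[of 0 "1 / t"] 4 r by simp_all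
    ultimately show ?thesis
      unfolding concurrent_def by blast
  qed
qed

section \<open>Perspectivity of the corner centers\<close>

theorem theorem2p1:
  fixes A B C D E F :: "real^2" and L :: "(real^2) set"
    and G H I :: "real^3" and n :: nat
  assumes "\<not> collinear {A, B, C}"
    and "admissible_transversal L A B C"
    and "D \<in> L \<inter> sideline B C"
    and "E \<in> L \<inter> sideline C A"
    and "F \<in> L \<inter> sideline A B"
    and "n \<in> {3, 4, 19, 24, 25, 48, 49, 63, 68, 69, 92, 93, 184, 186, 264, 265,
               304, 305, 317, 328, 340, 378, 563, 847}"
    and "is_center n A E F G"
    and "is_center n B F D H"
    and "is_center n C D E I"
    and "\<not> same_point (homog A) G"
    and "\<not> same_point (homog B) H"
    and "\<not> same_point (homog C) I"
  shows "perspective (homog A) (homog B) (homog C) G H I"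
proof -
  define g where "g = center_fun n"
  have g: "g (pi - x) = - g x" for x
    unfolding g_def using center_fun_pi_minus[OF assms(6)] .
  have L: "collinear L" "A \<notin> L" "B \<notin> L" "C \<notin> L"
    using assms(2) by (auto simp: admissible_transversal_def is_line_def collinear_aff_dim)

  obtain dB dC where D: "D = dB *\<^sub>R B + dC *\<^sub>R C" "dB + dC = 1" "dB \<noteq> 0" "dC \<noteq> 0"
    using assms(3) L by (auto simp: sideline_def elim!: affine_hull_2_obtain)
  obtain eC eA where E: "E = eC *\<^sub>R C + eA *\<^sub>R A" "eC + eA = 1" "eC \<noteq> 0" "eA \<noteq> 0"
    using assms(4) L by (auto simp: sideline_def elim!: affine_hull_2_obtain)
  obtain fA fB where F: "F = fA *\<^sub>R A + fB *\<^sub>R B" "fA + fB = 1" "fA \<noteq> 0" "fB \<noteq> 0"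
    using assms(5) L by (auto simp: sideline_def elim!: affine_hull_2_obtain)

  have unique: "x = x' \<and> y = y' \<and> z = z'"
    if "x *\<^sub>R A + y *\<^sub>R B + z *\<^sub>R C = x' *\<^sub>R A + y' *\<^sub>R B + z' *\<^sub>R C" "x + y + z = x' + y' + z'"
    for x y z x' y' z'
    using noncollinear_coeffs_zero[OF assms(1), of "x - x'" "y - y'" "z - z'"] that
    by (simp add: algebra_simps)

  have "D \<noteq> E"
    using unique[of 0 dB dC eA 0 eC] D E by (auto simp: add_ac)
  moreover have "collinear {D, E, F}"
    using assms(3-5) by (intro collinear_subset[OF L(1)]) auto
  ultimately have "F \<in> affine hull {D, E}"
    by (simp add: collinear_3_affine_hull)
  then obtain k m where F': "F = k *\<^sub>R D + m *\<^sub>R E" and km: "k + m = 1"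
    unfolding affine_hull_2 by blast
  have eqs: "fA = m * eA" "fB = k * dB" "0 = k * dC + m * eC"
  proof -
    have "fA *\<^sub>R A + fB *\<^sub>R B + 0 *\<^sub>R C
        = (m * eA) *\<^sub>R A + (k * dB) *\<^sub>R B + (k * dC + m * eC) *\<^sub>R C"
      using F F' D E by (simp add: algebra_simps)
    moreover have "m * eA + k * dB + (k * dC + m * eC) = k * (dB + dC) + m * (eC + eA)"
      by (simp add: algebra_simps)
    then have "fA + fB + 0 = m * eA + k * dB + (k * dC + m * eC)"
      using F(2) D(2) E(2) km by simp
    ultimately show "fA = m * eA" "fB = k * dB" "0 = k * dC + m * eC"
      using unique by blast+
  qed
  have k: "k \<noteq> 0" and m: "m \<noteq> 0"
    using eqs F by auto
  have menelaus: "eC * fA * dB = - (eA * fB * dC)"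
  proof -
    have "eC * fA * dB + eA * fB * dC = eA * dB * (k * dC + m * eC)"
      unfolding eqs(1,2) by (simp add: algebra_simps)
    then show ?thesis
      using eqs(3) by simp
  qed

  have coeffs: "dC = 1 - dB" "eA = 1 - eC" "fB = 1 - fA" "m = 1 - k"
    using D(2) E(2) F(2) km by simp_all
  have diffs:
    "A - E = eC *\<^sub>R (A - C)" "C - E = (- eA) *\<^sub>R (A - C)"
    "B - D = dC *\<^sub>R (B - C)" "C - D = (- dB) *\<^sub>R (B - C)"
    "A - F = fB *\<^sub>R (A - B)" "B - F = (- fA) *\<^sub>R (A - B)"
    unfolding D(1) E(1) F(1) coeffs by (simp_all add: algebra_simps)
  have diffs':
    "F - E = k *\<^sub>R (D - E)" "D - E = 1 *\<^sub>R (D - E)"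
    "F - D = (- m) *\<^sub>R (D - E)" "E - D = (- 1) *\<^sub>R (D - E)"
    "D - F = m *\<^sub>R (D - E)" "E - F = (- k) *\<^sub>R (D - E)"
    unfolding F' coeffs by (simp_all add: algebra_simps)

  \<comment> \<open>Both angles at each of \<open>D\<close>, \<open>E\<close>, \<open>F\<close> are compared with that between fixed direction
      vectors of the sideline and of the transversal.\<close>
  define \<gamma> where "\<gamma> u = g (arccos ((u \<bullet> (D - E)) / (norm u * norm (D - E))))" for u
  have sym: "angle_at P Q R = angle_at R Q P" for P Q R
    by (simp add: angle_at_def inner_commute mult.commute)
  have angles:
    "g (angle_at A E F) = sgn eC * sgn k * \<gamma> (A - C)"
    "g (angle_at D E C) = - sgn eA * \<gamma> (A - C)"
    "g (angle_at B F D) = - sgn fA * sgn m * \<gamma> (A - B)"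
    "g (angle_at E F A) = - sgn fB * sgn k * \<gamma> (A - B)"
    "g (angle_at C D E) = sgn dB * \<gamma> (B - C)"
    "g (angle_at F D B) = - sgn dC * sgn m * \<gamma> (B - C)"
    using odd_fun_angle_at[of g, OF g E(3) k diffs(1) diffs'(1)]
      odd_fun_angle_at[of g, OF g _ _ diffs(2) diffs'(2)] E(4)
      odd_fun_angle_at[of g, OF g _ m diffs(6) diffs'(5)] F(3)
      odd_fun_angle_at[of g, OF g F(4) _ diffs(5) diffs'(6)] k
      odd_fun_angle_at[of g, OF g _ _ diffs(4) diffs'(4)] D(3)
      odd_fun_angle_at[of g, OF g D(4) _ diffs(3) diffs'(3)] m
      sym[of D E C] sym[of E F A] sym[of F D B]
    by (simp_all add: \<gamma>_def sgn_minus)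

  have ceva:
    "(g (angle_at A E F) * eC) * (g (angle_at B F D) * fA) * (g (angle_at C D E) * dB)
     = (g (angle_at E F A) * fB) * (g (angle_at F D B) * dC) * (g (angle_at D E C) * eA)"
    (is "?l = ?r")
  proof -
    let ?c = "- sgn k * sgn m * \<gamma> (A - C) * \<gamma> (A - B) * \<gamma> (B - C)"
    have "?l = ?c * ((eC * sgn eC) * (fA * sgn fA) * (dB * sgn dB))"
      unfolding angles by (simp add: mult_ac)
    also have "\<dots> = ?c * \<bar>eC * fA * dB\<bar>"
      by (simp only: abs_sgn[symmetric] abs_mult)
    also have "\<dots> = ?c * \<bar>eA * fB * dC\<bar>"
      unfolding menelaus by simp
    also have "\<dots> = ?c * ((eA * sgn eA) * (fB * sgn fB) * (dC * sgn dC))"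
      by (simp only: abs_sgn[symmetric] abs_mult)
    also have "\<dots> = ?r"
      unfolding angles by (simp add: mult_ac)
    finally show ?thesis .
  qed

  have G: "has_barycentrics G A E F (g (angle_at F A E)) (g (angle_at A E F)) (g (angle_at E F A))"
    and H: "has_barycentrics H B F D (g (angle_at D B F)) (g (angle_at B F D)) (g (angle_at F D B))"
    and I: "has_barycentrics I C D E (g (angle_at E C D)) (g (angle_at C D E)) (g (angle_at D E C))"
    using assms(7-9) by (simp_all add: is_center_def Let_def g_def)
  have E': "E = eA *\<^sub>R A + eC *\<^sub>R C" "eA + eC = 1"
    and F'': "F = fB *\<^sub>R B + fA *\<^sub>R A" "fB + fA = 1"
    and D': "D = dC *\<^sub>R C + dB *\<^sub>R B" "dC + dB = 1"
    using D E F by (simp_all add: add.commute)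
  note AG = corner_cevian[OF G assms(10) E' E(3) F(1,2,4)]
  note BH = corner_cevian[OF H assms(11) F'' F(3) D(1,2,4)]
  note CI = corner_cevian[OF I assms(12) D' D(3) E(1,2,4)]
  show ?thesis
    unfolding perspective_def
    by (rule ceva_concurrent[OF _ AG[THEN conjunct1] _ BH[THEN conjunct1] _ CI[THEN conjunct1] _ ceva])
       (use AG BH CI homog_independent[OF assms(1)] in blast)+
qed

end
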